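(* Let $S\neq\mathbb Z_{\ge 0}$ be a numerical semigroup, let $m\in S$ be nonzero, and let $c_1<\dots<c_n$ be the elements of $\mathbb Z_{\ge 0}\setminus S$. Let $f$ be an arbitrary function on $\mathbb Z_{\ge 0}$ with values in a commutative ring with unity, and let $p$ be an integer with $0<p\le m$. Then for every $k=1,\dots,p$ $$\sum_{i=1}^n\bigl(f(c_i+m)-f(c_i)\bigr)\Bigl(\sum_{J\subset T_i,\ |J|=p-1}e_{k-1}(f\{J\})\Bigr)=\sum_{I\subset S^{(m)},\ |I|=p}e_k(f\{I\})-\sum_{I\subset I_m,\ |I|=p}e_k(f\{I\}).$$ In particular, for $p=m$, $$\sum_{i=1}^n\bigl(f(c_i+m)-f(c_i)\bigr)e_{k-1}(f\{T_i\})=e_k(f\{S^{(m)}\})-e_k(f\{I_m\}),$$ and for $p=m$, $k=1$ this reads $$\sum_{c\in\mathbb Z_{\ge 0}\setminus S}\bigl(f(c+m)-f(c)\bigr)=\sum_{a\in S^{(m)}}f(a)-\sum_{i=0}^{m-1}f(i).$$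
   Context: A numerical semigroup is a set $S\subset\mathbb Z_{\ge 0}$ that contains $0$, is closed under addition and has finite complement in $\mathbb Z_{\ge 0}$. For a numerical semigroup $S$ and a nonzero $m\in S$, the Apéry set is $S^{(m)}:=\{s\in S: s-m\notin S\}$; it has exactly $m$ elements, one in each residue class mod $m$, and contains $0$. Put $I_m:=\{0,1,\dots,m-1\}$. With $\mathbb Z_{\ge 0}\setminus S=\{c_1<\dots<c_n\}$, let $S_0:=\mathbb Z_{\ge 0}$ and $S_i:=\mathbb Z_{\ge 0}\setminus\{c_1,\dots,c_i\}$ for $i=1,\dots,n$ (so $S_n=S$); each $S_i$ is a numerical semigroup containing $m$. For $i=1,\dots,n$ put $T_i:=S_i^{(m)}\setminus\{c_i+m\}=S_{i-1}^{(m)}\setminus\{c_i\}$, a set of $m-1$ elements. For a finite set $A\subset\mathbb Z_{\ge 0}$, $f\{A\}$ denotes the family $(f(a))_{a\in A}$ of $|A|$ values counted with multiplicity, in any order. The elementary symmetric functions are $e_k(x_1,\dots,x_r):=\sum_{i_1<\dots<i_k}x_{i_1}\cdots x_{i_k}$, with $e_0=1$ (also for $r=0$). *)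

theory Defs
  imports Main
begin

definition numerical_semigroup :: "nat set \<Rightarrow> bool" where
  "numerical_semigroup S \<longleftrightarrow>
     0 \<in> S \<and> (\<forall>s\<in>S. \<forall>t\<in>S. s + t \<in> S) \<and> finite (UNIV - S)"

text \<open>The difference is taken in the integers, since subtraction on \<^typ>\<open>nat\<close> truncates.\<close>

definition apery :: "nat set \<Rightarrow> nat \<Rightarrow> nat set" where
  "apery S m = {s \<in> S. int s - int m \<notin> int ` S}"

text \<open>In the next two definitions \<open>c 1 < \<dots> < c n\<close> enumerates the gaps of a semigroup \<open>S\<close>;
  indices start at 1, so that \<open>gap_semigroup c 0 = UNIV\<close> and \<open>gap_semigroup c n = S\<close>.\<close>

definition gap_semigroup :: "(nat \<Rightarrow> nat) \<Rightarrow> nat \<Rightarrow> nat set" where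
  "gap_semigroup c i = UNIV - c ` {1..i}"

definition T_set :: "(nat \<Rightarrow> nat) \<Rightarrow> nat \<Rightarrow> nat \<Rightarrow> nat set" where
  "T_set c m i = apery (gap_semigroup c i) m - {c i + m}"

text \<open>\<open>esym k f A\<close> is \<open>e\<^sub>k\<close> of the family \<open>(f a)\<close> indexed by \<open>a \<in> A\<close>, for finite \<open>A\<close>: the
  summation is over sets of indices, so equal values are counted with multiplicity.
  The sort is that of commutative rings with unity; unlike \<^class>\<open>comm_ring_1\<close> it does not
  exclude the zero ring.\<close>

definition esym :: "nat \<Rightarrow> (nat \<Rightarrow> 'a::{comm_ring, comm_monoid_mult}) \<Rightarrow> nat set \<Rightarrow> 'a" where
  "esym k f A = (\<Sum>J | J \<subseteq> A \<and> card J = k. \<Prod>a\<in>J. f a)"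

end

(* The Apery sets of S_{i-1} and S_i arise from T_i by adjoining c_i and c_i + m, respectively.
   Exchanging one element y of a finite set for x changes the sum of e_k over all p-subsets by
   (f x - f y) times the sum of e_{k-1} over the (p-1)-subsets of the common part, and these
   differences telescope from S_0, whose Apery set is {0..<m}, to S_n = S. *)

theory Submission
  imports Defs
begin

text \<open>Split the subsets according to whether they contain \<open>x\<close>; deleting
  \<open>x\<close> is a bijection from those that do onto the \<open>q\<close>-subsets of
  \<open>B\<close>. The summand \<open>g\<close> is arbitrary because the split is needed twice: for
  the monomials inside \<open>esym\<close>, and for the outer sum of values of
  \<open>esym\<close>.\<close>

lemma sum_card_subsets_insert:
  fixes g :: "'b set \<Rightarrow> 'a::comm_monoid_add"
  assumes "finite B" "x \<notin> B"
  shows "(\<Sum>I | I \<subseteq> insert x B \<and> card I = Suc q. g I)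
    = (\<Sum>I | I \<subseteq> B \<and> card I = Suc q. g I) + (\<Sum>J | J \<subseteq> B \<and> card J = q. g (insert x J))"
proof -
  let ?A = "\<lambda>r. {I. I \<subseteq> B \<and> card I = r}"
  have split: "{I. I \<subseteq> insert x B \<and> card I = Suc q} = ?A (Suc q) \<union> insert x ` ?A q"
  proof (intro equalityI subsetI)
    fix I assume I: "I \<in> {I. I \<subseteq> insert x B \<and> card I = Suc q}"
    show "I \<in> ?A (Suc q) \<union> insert x ` ?A q"
    proof (cases "x \<in> I")
      case True
      then have "I = insert x (I - {x})" "I - {x} \<in> ?A q"
        using I by (auto simp: card_Diff_singleton)
      then show ?thesis by blast
    qed (use I in auto)
  next
    fix I assume "I \<in> ?A (Suc q) \<union> insert x ` ?A q"
    moreover have "card (insert x J) = Suc (card J)" if "J \<subseteq> B" for J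
      using that assms by (metis card_insert_disjoint finite_subset subsetD)
    ultimately show "I \<in> {I. I \<subseteq> insert x B \<and> card I = Suc q}" by auto
  qed
  have inj: "inj_on (insert x) (?A q)"
    using assms(2) by (intro inj_onI) (metis (mono_tags, lifting) insert_ident mem_Collect_eq subsetD)
  have "sum g (?A (Suc q) \<union> insert x ` ?A q) = sum g (?A (Suc q)) + sum g (insert x ` ?A q)"
    using assms by (intro sum.union_disjoint) auto
  then show ?thesis
    unfolding split by (simp add: sum.reindex[OF inj])
qed

lemma esym_Suc_insert:
  assumes "finite J" "x \<notin> J"
  shows "esym (Suc k) f (insert x J) = esym (Suc k) f J + f x * esym k f J"
proof -
  have "(\<Prod>a\<in>insert x K. f a) = f x * (\<Prod>a\<in>K. f a)" if "K \<subseteq> J" for K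
    using that assms by (metis finite_subset prod.insert subsetD)
  then show ?thesis
    unfolding esym_def
    by (simp add: sum_card_subsets_insert[OF assms] sum_distrib_left)
qed

lemma esym_0:
  assumes "finite A"
  shows "esym 0 f A = 1"
proof -
  have "{J. J \<subseteq> A \<and> card J = 0} = {{}}"
    using assms by (auto dest: finite_subset)
  then show ?thesis by (simp add: esym_def)
qed

lemma esym_1: "esym (Suc 0) f A = sum f A"
proof -
  have "{J. J \<subseteq> A \<and> card J = Suc 0} = (\<lambda>a. {a}) ` A"
    by (auto simp: card_Suc_eq)
  then show ?thesis by (simp add: esym_def sum.reindex)
qed

lemma sum_esym_exchange:
  fixes f :: "nat \<Rightarrow> 'a::{comm_ring, comm_monoid_mult}"
  assumes "finite B" "x \<notin> B" "y \<notin> B"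
  shows "(\<Sum>I | I \<subseteq> insert x B \<and> card I = Suc q. esym (Suc k) f I)
      - (\<Sum>I | I \<subseteq> insert y B \<and> card I = Suc q. esym (Suc k) f I)
    = (f x - f y) * (\<Sum>J | J \<subseteq> B \<and> card J = q. esym k f J)"
proof -
  \<comment> \<open>Only the last of the three summands depends on \<open>f z\<close>; the other two
    involve \<open>B\<close> alone and cancel when the instances for \<open>x\<close> and
    \<open>y\<close> are subtracted.\<close>
  have insert: "(\<Sum>I | I \<subseteq> insert z B \<and> card I = Suc q. esym (Suc k) f I)
    = (\<Sum>I | I \<subseteq> B \<and> card I = Suc q. esym (Suc k) f I)
      + ((\<Sum>J | J \<subseteq> B \<and> card J = q. esym (Suc k) f J)
      + f z * (\<Sum>J | J \<subseteq> B \<and> card J = q. esym k f J))" if z: "z \<notin> B" for z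
  proof -
    have "(\<Sum>J | J \<subseteq> B \<and> card J = q. esym (Suc k) f (insert z J))
      = (\<Sum>J | J \<subseteq> B \<and> card J = q. esym (Suc k) f J + f z * esym k f J)"
      using z assms(1) by (intro sum.cong) (auto intro!: esym_Suc_insert dest: finite_subset)
    then show ?thesis
      by (simp add: sum_card_subsets_insert[OF assms(1) z] sum.distrib sum_distrib_left)
  qed
  show ?thesis
    by (simp add: insert[OF assms(2)] insert[OF assms(3)] left_diff_distrib)
qed

text \<open>This removes the integer subtraction: for \<open>s < m\<close> no \<open>t\<close>
  exists, matching the fact that a negative difference never lies in \<open>S\<close>.\<close>

lemma in_apery_iff: "s \<in> apery S m \<longleftrightarrow> s \<in> S \<and> (\<forall>t. s = t + m \<longrightarrow> t \<notin> S)"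
  unfolding apery_def image_iff by (auto simp: algebra_simps simp flip: of_nat_add)

lemma apery_UNIV: "apery UNIV m = {0..<m}"
  by (auto simp: in_apery_iff) (metis le_add_diff_inverse2 not_less)

lemma card_subsets_card_eq: "finite A \<Longrightarrow> {J. J \<subseteq> A \<and> card J = card A} = {A}"
  by (auto dest: card_subset_eq)

text \<open>Passing from S_{i-1} to S_i deletes only \<open>c i\<close>, so Apery membership can
  change only at \<open>c i\<close>, which is lost, and at \<open>c i + m\<close>, which enters
  because its predecessor modulo \<open>m\<close> has gone.\<close>

lemma apery_gap_semigroup_step:
  assumes S: "numerical_semigroup S" and m: "m \<in> S" "m \<noteq> 0"
    and mono: "strict_mono_on {1..n} c" and gaps: "c ` {1..n} = UNIV - S"
    and i: "i \<in> {1..n}"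
  shows "apery (gap_semigroup c i) m = insert (c i + m) (T_set c m i)"
    and "apery (gap_semigroup c (i - 1)) m = insert (c i) (T_set c m i)"
    and "c i \<notin> T_set c m i"
proof -
  have less: "c j < c l \<longleftrightarrow> j < l" if "j \<in> {1..n}" "l \<in> {1..n}" for j l
    using mono that by (simp add: strict_mono_on_less)
  \<comment> \<open>As \<open>c\<close> is increasing, conditions on indices become conditions on
    values. The bound is weak in the first case since \<open>i - 1 < j\<close> means i \<le> j, and
    strict in the second.\<close>
  have prev: "x \<in> gap_semigroup c (i - 1) \<longleftrightarrow> x \<in> S \<or> c i \<le> x"
    and this_gap: "x \<in> gap_semigroup c i \<longleftrightarrow> x \<in> S \<or> c i < x" for x
  proof -
    have *: "x \<in> gap_semigroup c l \<longleftrightarrow> (\<forall>j\<in>{1..n}. x = c j \<longrightarrow> l < j)" if "l \<le> n" for l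
      using that by (auto simp: gap_semigroup_def image_iff)
    have x: "x \<in> S \<longleftrightarrow> x \<notin> c ` {1..n}"
      using gaps by auto
    show "x \<in> gap_semigroup c (i - 1) \<longleftrightarrow> x \<in> S \<or> c i \<le> x"
      unfolding x using i less by (subst *) (auto simp: not_less[symmetric])
    show "x \<in> gap_semigroup c i \<longleftrightarrow> x \<in> S \<or> c i < x"
      unfolding x using i less by (subst *) auto
  qed
  have ci: "c i \<notin> S" using gaps i by blast
  have add: "t + m \<in> S" if "t \<in> S" for t
    using S m that by (auto simp: numerical_semigroup_def)
  have new: "c i + m \<in> apery (gap_semigroup c i) m"
    using ci m by (auto simp: in_apery_iff this_gap)
  then show "apery (gap_semigroup c i) m = insert (c i + m) (T_set c m i)"
    by (auto simp: T_set_def)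
  show "c i \<notin> T_set c m i"
    using ci by (auto simp: T_set_def in_apery_iff this_gap)
  have "x \<in> apery (gap_semigroup c (i - 1)) m \<longleftrightarrow> x \<in> insert (c i) (T_set c m i)" for x
  proof (cases "x = c i")
    case True
    \<comment> \<open>Such a \<open>t\<close> cannot lie in \<open>S\<close>, or else
      \<open>c i\<close> would too, and it is below \<open>c i\<close> because \<open>m\<close> is
      positive.\<close>
    have "t \<notin> gap_semigroup c (i - 1)" if "c i = t + m" for t
      using that ci add m by (auto simp: prev simp del: One_nat_def)
    then show ?thesis using True by (auto simp: in_apery_iff prev simp del: One_nat_def)
  next
    case False
    \<comment> \<open>If \<open>x = t + m\<close>, the two Apery conditions differ only in requiring
      \<open>t < c i\<close> or t \<le> \<open>c i\<close>; the boundary case \<open>t = c i\<close>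
      is the element \<open>c i + m\<close> left out of \<open>T_set\<close>.\<close>
    then show ?thesis
      by (auto simp: T_set_def in_apery_iff prev this_gap simp del: One_nat_def)
  qed
  then show "apery (gap_semigroup c (i - 1)) m = insert (c i) (T_set c m i)" by blast
qed

text \<open>Instead of counting residue classes, follow the chain from \<open>{0..<m}\<close>: each
  step exchanges one element for another over the common part \<open>T_set\<close>, which preserves
  the cardinality.\<close>

lemma finite_card_apery_gap_semigroup:
  assumes "numerical_semigroup S" "m \<in> S" "m \<noteq> 0"
    "strict_mono_on {1..n} c" "c ` {1..n} = UNIV - S" "i \<le> n"
  shows "finite (apery (gap_semigroup c i) m) \<and> card (apery (gap_semigroup c i) m) = m"
  using assms(6)
proof (induction i)
  case 0
  then show ?case by (simp add: gap_semigroup_def apery_UNIV)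
next
  case (Suc i)
  note step = apery_gap_semigroup_step[OF assms(1-5), of "Suc i"]
  have "c (Suc i) + m \<notin> T_set c m (Suc i)" by (simp add: T_set_def)
  with Suc step show ?case by (cases "finite (T_set c m (Suc i))") auto
qed

theorem mainTheorem3:
  fixes S :: "nat set" and m n :: nat and c :: "nat \<Rightarrow> nat"
    and f :: "nat \<Rightarrow> 'a::{comm_ring, comm_monoid_mult}"
  assumes "numerical_semigroup S" and "S \<noteq> UNIV"
    and "m \<in> S" and "m \<noteq> 0"
    and "strict_mono_on {1..n} c" and "c ` {1..n} = UNIV - S"
  shows "(\<forall>p k. 0 < p \<and> p \<le> m \<and> 1 \<le> k \<and> k \<le> p \<longrightarrow>
            (\<Sum>i=1..n. (f (c i + m) - f (c i)) *
                (\<Sum>J | J \<subseteq> T_set c m i \<and> card J = p - 1. esym (k - 1) f J))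
            = (\<Sum>I | I \<subseteq> apery S m \<and> card I = p. esym k f I)
              - (\<Sum>I | I \<subseteq> {0..<m} \<and> card I = p. esym k f I))
       \<and> (\<forall>k. 1 \<le> k \<and> k \<le> m \<longrightarrow>
            (\<Sum>i=1..n. (f (c i + m) - f (c i)) * esym (k - 1) f (T_set c m i))
            = esym k f (apery S m) - esym k f {0..<m})
       \<and> (\<Sum>x\<in>UNIV - S. f (x + m) - f x) = (\<Sum>a\<in>apery S m. f a) - (\<Sum>i=0..<m. f i)"
proof -
  note step = apery_gap_semigroup_step[OF assms(1,3-6)]
  have fin: "finite (T_set c m i)" "card (T_set c m i) = m - 1" if "i \<in> {1..n}" for i
  proof -
    have "c i + m \<notin> T_set c m i" by (simp add: T_set_def)
    then show "finite (T_set c m i)" "card (T_set c m i) = m - 1"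
      using finite_card_apery_gap_semigroup[OF assms(1,3-6), of i] that
      by (auto simp: step(1)[OF that])
  qed
  have gap_n: "gap_semigroup c n = S"
    using assms(6) by (auto simp: gap_semigroup_def)
  have fin_S: "finite (apery S m)" "card (apery S m) = m"
    using finite_card_apery_gap_semigroup[OF assms(1,3-6), of n] by (auto simp: gap_n)
  have main: "(\<Sum>i=1..n. (f (c i + m) - f (c i)) *
                (\<Sum>J | J \<subseteq> T_set c m i \<and> card J = p - 1. esym (k - 1) f J))
            = (\<Sum>I | I \<subseteq> apery S m \<and> card I = p. esym k f I)
              - (\<Sum>I | I \<subseteq> {0..<m} \<and> card I = p. esym k f I)"
    if "0 < p" "1 \<le> k" for p k
  proof -
    let ?G = "\<lambda>i. \<Sum>I | I \<subseteq> apery (gap_semigroup c i) m \<and> card I = p. esym k f I"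
    have "(f (c i + m) - f (c i)) *
        (\<Sum>J | J \<subseteq> T_set c m i \<and> card J = p - 1. esym (k - 1) f J) = ?G i - ?G (i - 1)"
      if i: "i \<in> {1..n}" for i
    proof -
      have "c i + m \<notin> T_set c m i" by (simp add: T_set_def)
      from sum_esym_exchange[OF fin(1)[OF i] this step(3)[OF i], where q = "p - 1" and k = "k - 1" and f = f]
      show ?thesis
        using \<open>0 < p\<close> \<open>1 \<le> k\<close> unfolding step(1,2)[OF i] by simp
    qed
    then have "(\<Sum>i=1..n. (f (c i + m) - f (c i)) *
        (\<Sum>J | J \<subseteq> T_set c m i \<and> card J = p - 1. esym (k - 1) f J))
        = (\<Sum>i=1..n. ?G i - ?G (i - 1))"
      by (rule sum.cong[OF refl])
    \<comment> \<open>The sum telescopes; since indices start at 1, \<open>i - 1\<close> never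
      truncates and the lower end is \<open>?G 0\<close>.\<close>
    also have "\<dots> = ?G n - ?G 0"
      by (induction n) auto
    finally show ?thesis
      \<comment> \<open>\<open>gap_n\<close> comes first, so that the upper end becomes
        \<open>S\<close> before \<open>gap_semigroup\<close> is unfolded to turn the lower end into
        \<open>UNIV\<close>.\<close>
      by (simp only: gap_n) (simp add: gap_semigroup_def apery_UNIV)
  qed
  have top: "(\<Sum>i=1..n. (f (c i + m) - f (c i)) * esym (k - 1) f (T_set c m i))
            = esym k f (apery S m) - esym k f {0..<m}" if "1 \<le> k" for k
  proof -
    \<comment> \<open>For \<open>p = m\<close> the prescribed sizes are the full cardinalities, so
      each sum over subsets has a single term.\<close>
    have "(\<Sum>J | J \<subseteq> T_set c m i \<and> card J = m - 1. esym (k - 1) f J)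
        = esym (k - 1) f (T_set c m i)" if "i \<in> {1..n}" for i
      using card_subsets_card_eq[OF fin(1)[OF that]] fin(2)[OF that] by simp
    moreover have "{I. I \<subseteq> apery S m \<and> card I = m} = {apery S m}"
      using card_subsets_card_eq[OF fin_S(1)] fin_S(2) by simp
    moreover have "{I. I \<subseteq> {0..<m} \<and> card I = m} = {{0..<m}}"
      using card_subsets_card_eq[of "{0..<m}"] by simp
    ultimately show ?thesis
      using main[of m k] that assms(4) by simp
  qed
  have "inj_on c {1..n}"
    using assms(5) by (rule strict_mono_on_imp_inj_on)
  then have "(\<Sum>x\<in>UNIV - S. f (x + m) - f x) = (\<Sum>i=1..n. f (c i + m) - f (c i))"
    unfolding assms(6)[symmetric] by (simp add: sum.reindex)
  \<comment> \<open>The factor inserted is e_0 = 1, which brings the sum into the form of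
    \<open>top\<close> with \<open>k = 1\<close>.\<close>
  also have "\<dots> = (\<Sum>i=1..n. (f (c i + m) - f (c i)) * esym (1 - 1) f (T_set c m i))"
    using fin(1) by (intro sum.cong) (simp_all add: esym_0)
  also have "\<dots> = (\<Sum>a\<in>apery S m. f a) - (\<Sum>i=0..<m. f i)"
    using top[of 1] by (simp add: esym_1)
  finally show ?thesis using main top by blast
qed

end
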